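(* Let $\mathbf{j}\in\mathbb{N}^n$ and $\mathbf{a}=(a_1,\dots,a_n)^T\in\mathbb{R}^n$ with $\mathbf{a}^T(\mathbf{j}+\mathbf{1})=0$, and consider the elementary divergence-free vector field $$\dot x_i=a_i\,x_i\,\mathbf{x}^{\mathbf{j}},\qquad i=1,\dots,n, \qquad ( * )$$ associated to the monomial $\mathbf{x}^{\mathbf{j}}$. Along solutions of $( * )$ the function $\mathbf{x}^{\mathbf{j}}(t)$ obeys the differential equation $$\frac{\mathrm{d}}{\mathrm{d}t}\mathbf{x}^{\mathbf{j}}=c_{\mathbf{j}}\,\mathbf{x}^{2\mathbf{j}},\qquad\text{where } c_{\mathbf{j}}=\mathbf{a}^T\mathbf{j}.$$ Furthermore, given an initial value $\mathbf{x}(t_0)\in\mathbb{R}^n$ and $\Delta t>0$ with $\Delta t<\dfrac{1}{|c_{\mathbf{j}}\,\mathbf{x}^{\mathbf{j}}(t_0)|}$ (no restriction if $c_{\mathbf{j}}\mathbf{x}^{\mathbf{j}}(t_0)=0$), the solution of $( * )$ on $[t_0,t_0+\Delta t]$ is $$x_i(t)=\begin{cases} x_i(t_0)\Big(1-c_{\mathbf{j}}\,\mathbf{x}^{\mathbf{j}}(t_0)(t-t_0)\Big)^{-r^i_{\mathbf{j}}} & \text{if } c_{\mathbf{j}}\neq 0,\\[4pt] x_i(t_0)\,\mathrm{e}^{a_i\mathbf{x}^{\mathbf{j}}(t_0)(t-t_0)} & \text{if } c_{\mathbf{j}}=0,\end{cases}$$ for $i=1,\dots,n$, where $r^i_{\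mathbf{j}}=a_i/c_{\mathbf{j}}$.
   Context: Here $\mathbb{N}$ includes $0$, $\mathbf{1}=(1,\dots,1)^T$, $\mathbf{x}^{\mathbf{j}}=x_1^{j_1}\cdots x_n^{j_n}$, and $\mathbf{x}^{\mathbf{j}}(t)$ denotes $\mathbf{x}^{\mathbf{j}}$ evaluated at the solution $\mathbf{x}(t)$. The condition $\mathbf{a}^T(\mathbf{j}+\mathbf{1})=0$ is equivalent to the vector field $( * )$ having zero divergence; "elementary divergence-free vector field" means a field of the form $( * )$ satisfying this condition. *)

theory Defs
  imports "HOL-Analysis.Analysis"
begin

definition monomial :: "nat ^ 'n \<Rightarrow> real ^ 'n \<Rightarrow> real" where
  "monomial j x = (\<Prod>i\<in>UNIV. (x $ i) ^ (j $ i))"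

definition real_vec :: "nat ^ 'n \<Rightarrow> real ^ 'n" where
  "real_vec j = (\<chi> i. real (j $ i))"

definition elementary_field :: "real ^ 'n \<Rightarrow> nat ^ 'n \<Rightarrow> real ^ 'n \<Rightarrow> real ^ 'n" where
  "elementary_field a j x = (\<chi> i. a $ i * x $ i * monomial j x)"

text \<open>The derivative is taken within \<open>T\<close>, hence is one-sided at endpoints belonging to \<open>T\<close>.\<close>

definition is_solution_on ::
    "(real ^ 'n \<Rightarrow> real ^ 'n) \<Rightarrow> real set \<Rightarrow> (real \<Rightarrow> real ^ 'n) \<Rightarrow> bool" where
  "is_solution_on f T x \<longleftrightarrow> (\<forall>t\<in>T. (x has_vector_derivative f (x t)) (at t within T))"

definition growth_coeff :: "real ^ 'n \<Rightarrow> nat ^ 'n \<Rightarrow> real" where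
  "growth_coeff a j = a \<bullet> real_vec j"

text \<open>The real power \<open>powr\<close> is used only where its base is positive, namely for
  \<open>\<bar>growth_coeff a j * monomial j x0 * (t - t0)\<bar> < 1\<close>.\<close>

definition explicit_solution ::
    "real ^ 'n \<Rightarrow> nat ^ 'n \<Rightarrow> real \<Rightarrow> real ^ 'n \<Rightarrow> real \<Rightarrow> real ^ 'n" where
  "explicit_solution a j t0 x0 t = (\<chi> i.
     if growth_coeff a j \<noteq> 0
     then x0 $ i * (1 - growth_coeff a j * monomial j x0 * (t - t0)) powr
            (- (a $ i / growth_coeff a j))
     else x0 $ i * exp (a $ i * monomial j x0 * (t - t0)))"

end

theory Submission
  imports Defs
begin

text \<open>
  The product rule turns the equations for the coordinates into \<open>m' = c m\<^sup>2\<close> for the monomial \<open>m\<close>.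
  The difference \<open>w\<close> of two solutions \<open>m\<close>, \<open>q\<close> of this equation solves the homogeneous linear
  equation \<open>w' = c (m + q) w\<close>, so \<open>m = m0 / (1 - c m0 (t - t0))\<close>. Once \<open>m\<close> is known, the system
  consists of decoupled linear equations \<open>x\<^sub>i' = a\<^sub>i m x\<^sub>i\<close>, whose solutions are again unique.
\<close>

text \<open>Integrating factor: with \<open>G\<close> an antiderivative of \<open>g\<close>, the
  function \<open>exp (- G s) * (f s - h s)\<close> has derivative zero, so it keeps the value 0
  that it has at \<open>a\<close>.\<close>

lemma linear_ode_unique:
  fixes f h g :: "real \<Rightarrow> real"
  assumes g: "continuous_on {a..b} g"
    and f: "\<And>t. t \<in> {a..b} \<Longrightarrow> (f has_real_derivative g t * f t) (at t within {a..b})"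
    and h: "\<And>t. t \<in> {a..b} \<Longrightarrow> (h has_real_derivative g t * h t) (at t within {a..b})"
    and eq: "f a = h a"
    and t: "t \<in> {a..b}"
  shows "f t = h t"
proof -
  define G where "G s = integral {a..s} g" for s
  define D where "D s = exp (- G s) * (f s - h s)" for s
  have G: "(G has_real_derivative g s) (at s within {a..b})" if "s \<in> {a..b}" for s
    unfolding G_def using integral_has_real_derivative[OF g that] .
  have "(D has_real_derivative 0) (at s within {a..b})" if "s \<in> {a..b}" for s
    unfolding D_def
    by (rule derivative_eq_intros refl G f h that)+ (simp add: algebra_simps)
  then obtain k where k: "D s = k" if "s \<in> {a..b}" for s
    using has_field_derivative_zero_constant[of "{a..b}" D] by auto
  have "D t = D a"
    using t k by auto
  then show ?thesis
    by (simp add: D_def eq)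
qed

text \<open>Logarithmic derivatives add up over a product. Writing each derivative as
  \<open>g i * f i t\<close> avoids dividing by \<open>f i t\<close>, which may vanish.\<close>

lemma has_real_derivative_prod_power:
  fixes f :: "'a \<Rightarrow> real \<Rightarrow> real"
  assumes "finite S"
    and "\<And>i. i \<in> S \<Longrightarrow> (f i has_real_derivative g i * f i t) (at t within T)"
  shows "((\<lambda>s. \<Prod>i\<in>S. f i s ^ k i) has_real_derivative
           (\<Sum>i\<in>S. g i * real (k i)) * (\<Prod>i\<in>S. f i t ^ k i)) (at t within T)"
  using assms
proof (induction S)
  case empty
  then show ?case by simp
next
  case (insert i S)
  \<comment> \<open>At \<open>n = 0\<close> the truncated exponent \<open>n - 1\<close> is harmless,
    since the factor \<open>real n\<close> vanishes.\<close>
  have pow: "real n * z ^ (n - 1) * z = real n * z ^ n" for n and z :: real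
    by (cases n) auto
  have i: "((\<lambda>s. f i s ^ k i) has_real_derivative g i * real (k i) * f i t ^ k i) (at t within T)"
    using DERIV_power[OF insert.prems[of i], of "k i"] pow[of "k i" "f i t"]
    by (cases "k i = 0") (auto simp: algebra_simps)
  have S: "((\<lambda>s. \<Prod>i\<in>S. f i s ^ k i) has_real_derivative
      (\<Sum>i\<in>S. g i * real (k i)) * (\<Prod>i\<in>S. f i t ^ k i)) (at t within T)"
    using insert by simp
  show ?case
    using DERIV_mult[OF i S] insert.hyps by (simp add: algebra_simps)
qed

text \<open>The factor \<open>p\<close> is left free: for a solution it is the monomial itself,
  while for the explicit formula it is a given rational function not yet known to be the
  monomial.\<close>

lemma has_real_derivative_monomial:
  fixes a :: "real ^ 'n" and j :: "nat ^ 'n"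
  assumes "\<And>i. ((\<lambda>s. x s $ i) has_real_derivative a $ i * p * x t $ i) (at t within T)"
  shows "((\<lambda>s. monomial j (x s)) has_real_derivative
           growth_coeff a j * p * monomial j (x t)) (at t within T)"
  using has_real_derivative_prod_power[of UNIV "\<lambda>i s. x s $ i" "\<lambda>i. a $ i * p" t T "\<lambda>i. j $ i"] assms
  by (simp add: monomial_def growth_coeff_def real_vec_def inner_vec_def sum_distrib_left mult_ac)

lemma is_solution_on_elementary_field_iff:
  "is_solution_on (elementary_field a j) T x \<longleftrightarrow>
     (\<forall>t\<in>T. \<forall>i. ((\<lambda>s. x s $ i) has_real_derivative a $ i * monomial j (x t) * x t $ i)
                  (at t within T))"
proof -
  have "(x has_vector_derivative elementary_field a j (x t)) (at t within T) \<longleftrightarrow>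
      (\<forall>i. ((\<lambda>s. x s $ i) has_real_derivative a $ i * monomial j (x t) * x t $ i) (at t within T))" for t
    unfolding has_vector_derivative_def has_real_derivative_iff_has_vector_derivative
    by (subst has_derivative_componentwise_within)
       (auto simp: Basis_vec_def inner_axis elementary_field_def mult_ac)
  then show ?thesis
    by (simp add: is_solution_on_def)
qed

lemma monomial_has_real_derivative_on_solution:
  assumes "is_solution_on (elementary_field a j) T x" and "t \<in> T"
  shows "((\<lambda>s. monomial j (x s)) has_real_derivative
           growth_coeff a j * monomial j (x t) * monomial j (x t)) (at t within T)"
  using assms by (intro has_real_derivative_monomial) (simp add: is_solution_on_elementary_field_iff)

lemma monomial_double: "monomial (2 *s j) x = monomial j x * monomial j x"
  by (simp add: monomial_def mult_2 power_add prod.distrib)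

lemma explicit_solution_initial: "explicit_solution a j t0 x0 t0 = x0"
  by (simp add: explicit_solution_def vec_eq_iff)

text \<open>The coefficient contains the expected closed form of the monomial along the solution.
  That the monomial of the formula really has this value is a separate step.\<close>

lemma explicit_solution_derivative:
  assumes "0 < 1 - growth_coeff a j * monomial j x0 * (t - t0)"
  shows "((\<lambda>s. explicit_solution a j t0 x0 s $ i) has_real_derivative
           a $ i * (monomial j x0 / (1 - growth_coeff a j * monomial j x0 * (t - t0))) *
             explicit_solution a j t0 x0 t $ i) (at t within T)"
proof (cases "growth_coeff a j = 0")
  case True
  then show ?thesis
    by (auto simp: explicit_solution_def intro!: derivative_eq_intros)
next
  case False
  define c where "c = growth_coeff a j"
  define m where "m = monomial j x0"
  have u: "0 < 1 - c * m * (t - t0)" and c: "c \<noteq> 0"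
    using assms False by (simp_all add: c_def m_def)
  \<comment> \<open>Differentiating the power lowers its exponent by one; splitting off that factor
    leaves the original power over the base, and the inner derivative \<open>- (c * m)\<close>
    cancels the \<open>c\<close> in the exponent.\<close>
  have powr: "(1 - c * m * (t - t0)) powr (- (a $ i / c) - 1)
      = (1 - c * m * (t - t0)) powr (- (a $ i / c)) / (1 - c * m * (t - t0))"
    using u by (simp add: powr_diff)
  have "((\<lambda>s. x0 $ i * (1 - c * m * (s - t0)) powr (- (a $ i / c))) has_real_derivative
      a $ i * (m / (1 - c * m * (t - t0))) *
        (x0 $ i * (1 - c * m * (t - t0)) powr (- (a $ i / c)))) (at t within T)"
    using u c by (auto intro!: derivative_eq_intros simp: powr)
  then show ?thesis
    using c by (simp add: explicit_solution_def c_def m_def)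
qed

lemma denominator_pos:
  fixes k :: real
  assumes "k \<noteq> 0 \<longrightarrow> d < 1 / \<bar>k\<bar>" and "t \<in> {t0..t0 + d}"
  shows "0 < 1 - k * (t - t0)"
proof (cases "k = 0")
  case False
  have "k * (t - t0) \<le> \<bar>k\<bar> * d"
    using assms(2) by (intro mult_mono) auto
  also have "\<dots> < 1"
    using assms(1) False by (simp add: field_simps)
  finally show ?thesis by simp
qed simp

text \<open>The bound on \<open>d\<close> keeps the pole of \<open>q\<close>, the solution of
  \<open>q' = c * q * q\<close> with initial value \<open>monomial j x0\<close>, outside the
  interval.\<close>

lemma
  fixes a :: "real ^ 'n" and j :: "nat ^ 'n"
  assumes d: "growth_coeff a j * monomial j x0 \<noteq> 0 \<longrightarrow> d < 1 / \<bar>growth_coeff a j * monomial j x0\<bar>"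
  shows is_solution_on_explicit_solution:
      "is_solution_on (elementary_field a j) {t0..t0 + d} (explicit_solution a j t0 x0)" (is ?existence)
    and explicit_solution_unique:
      "\<lbrakk>is_solution_on (elementary_field a j) {t0..t0 + d} x; x t0 = x0; t \<in> {t0..t0 + d}\<rbrakk>
        \<Longrightarrow> x t = explicit_solution a j t0 x0 t"
proof -
  define c where "c = growth_coeff a j"
  define q where "q s = monomial j x0 / (1 - c * monomial j x0 * (s - t0))" for s
  let ?I = "{t0..t0 + d}"
  let ?y = "explicit_solution a j t0 x0"
  have pos: "0 < 1 - c * monomial j x0 * (s - t0)" if "s \<in> ?I" for s
    using denominator_pos[OF d that] by (simp add: c_def)
  have q: "(q has_real_derivative c * q s * q s) (at s within ?I)" if "s \<in> ?I" for s
  proof -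
    have "((\<lambda>s. 1 - c * monomial j x0 * (s - t0)) has_real_derivative - (c * monomial j x0))
        (at s within ?I)"
      by (auto intro!: derivative_eq_intros)
    from DERIV_divide[OF DERIV_const this, of "monomial j x0"] show ?thesis
      unfolding q_def using pos[OF that] by (simp add: mult_ac)
  qed
  have q_cont: "continuous_on ?I q"
    using q by (rule DERIV_continuous_on)
  have q_init: "q t0 = monomial j x0"
    by (simp add: q_def)
  have y: "((\<lambda>s. ?y s $ i) has_real_derivative a $ i * q s * ?y s $ i) (at s within ?I)"
    if "s \<in> ?I" for i s
    using explicit_solution_derivative[of a j x0 s t0] pos[OF that] by (simp add: q_def c_def)
  \<comment> \<open>Both sides solve the linear equation \<open>w' = c * q * w\<close> and agree at
    \<open>t0\<close>, so no product of real powers has to be computed.\<close>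
  have "monomial j (?y s) = q s" if "s \<in> ?I" for s
  proof (rule linear_ode_unique[where f = "\<lambda>s. monomial j (?y s)" and h = q and g = "\<lambda>s. c * q s"])
    show "((\<lambda>s. monomial j (?y s)) has_real_derivative c * q s * monomial j (?y s)) (at s within ?I)"
      if "s \<in> ?I" for s
      unfolding c_def by (intro has_real_derivative_monomial y that)
  qed (use q q_init that in \<open>auto intro!: continuous_intros q_cont simp: explicit_solution_initial\<close>)
  then show ?existence
    using y by (simp add: is_solution_on_elementary_field_iff)

  show "x t = ?y t"
    if sol: "is_solution_on (elementary_field a j) ?I x" and init: "x t0 = x0" and t: "t \<in> ?I"
  proof -
    have m: "((\<lambda>s. monomial j (x s)) has_real_derivative
        c * monomial j (x s) * monomial j (x s)) (at s within ?I)" if "s \<in> ?I" for s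
      using monomial_has_real_derivative_on_solution[OF sol that] by (simp add: c_def)
    then have m_cont: "continuous_on ?I (\<lambda>s. monomial j (x s))"
      by (rule DERIV_continuous_on)
    \<comment> \<open>Factoring the difference of squares makes the equation linear in the
      difference, which is compared with the zero solution. The coefficient is continuous because
      the monomial and \<open>q\<close> are differentiable.\<close>
    have mq: "monomial j (x s) - q s = 0" if "s \<in> ?I" for s
    proof (rule linear_ode_unique[where f = "\<lambda>s. monomial j (x s) - q s" and h = "\<lambda>_. 0"
          and g = "\<lambda>s. c * (monomial j (x s) + q s)"])
      show "((\<lambda>s. monomial j (x s) - q s) has_real_derivative
          c * (monomial j (x s) + q s) * (monomial j (x s) - q s)) (at s within ?I)" if "s \<in> ?I" for s
        using DERIV_diff[OF m[OF that] q[OF that]] by (simp add: algebra_simps)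
    qed (use q_init init that in \<open>auto intro!: continuous_intros m_cont q_cont\<close>)
    \<comment> \<open>With the monomial replaced by \<open>q\<close>, this coordinate of both curves
      solves one linear equation with coefficient \<open>a $ i * q s\<close>.\<close>
    have "x t $ i = ?y t $ i" for i
    proof (rule linear_ode_unique[where f = "\<lambda>s. x s $ i" and h = "\<lambda>s. ?y s $ i"
          and g = "\<lambda>s. a $ i * q s"])
      show "((\<lambda>s. x s $ i) has_real_derivative a $ i * q s * x s $ i) (at s within ?I)" if "s \<in> ?I" for s
        using sol[unfolded is_solution_on_elementary_field_iff, rule_format, OF that, of i] mq[OF that]
        by simp
    qed (use y init t in \<open>auto intro!: continuous_intros q_cont simp: explicit_solution_initial\<close>)
    then show ?thesis
      by (simp add: vec_eq_iff)
  qed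
qed

theorem theorem2:
  fixes a :: "real ^ 'n" and j :: "nat ^ 'n"
  assumes "a \<bullet> (real_vec j + 1) = 0"
  shows "(\<forall>T x. is_interval T \<longrightarrow> is_solution_on (elementary_field a j) T x \<longrightarrow>
            (\<forall>t\<in>T. ((\<lambda>s. monomial j (x s)) has_real_derivative
                     growth_coeff a j * monomial (2 *s j) (x t)) (at t within T)))
       \<and> (\<forall>t0 x0 \<Delta>t. 0 < \<Delta>t \<longrightarrow>
            (growth_coeff a j * monomial j x0 \<noteq> 0 \<longrightarrow>
               \<Delta>t < 1 / \<bar>growth_coeff a j * monomial j x0\<bar>) \<longrightarrow>
            explicit_solution a j t0 x0 t0 = x0 \<and>
            is_solution_on (elementary_field a j) {t0..t0 + \<Delta>t} (explicit_solution a j t0 x0) \<and>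
            (\<forall>x. is_solution_on (elementary_field a j) {t0..t0 + \<Delta>t} x \<and> x t0 = x0 \<longrightarrow>
                 (\<forall>t\<in>{t0..t0 + \<Delta>t}. x t = explicit_solution a j t0 x0 t)))"
proof (intro conjI allI impI ballI; (elim conjE)?)
  fix T x t
  assume "is_solution_on (elementary_field a j) T x" and "t \<in> T"
  then show "((\<lambda>s. monomial j (x s)) has_real_derivative
      growth_coeff a j * monomial (2 *s j) (x t)) (at t within T)"
    using monomial_has_real_derivative_on_solution by (simp add: monomial_double mult.assoc)
\<comment> \<open>What remains is the initial value, existence and uniqueness, with \<Delta>t as the
  length \<open>d\<close>.\<close>
qed (rule explicit_solution_initial is_solution_on_explicit_solution explicit_solution_unique;
    assumption)+

end
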